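(* Consider a Bayesian network with nodes $C,A_1,\dots,A_n$ (finite-valued variables, with $C$ the class variable and $A_1,\dots,A_n$ the attribute variables), whose joint mass function $p_0$ is strictly positive everywhere. Let the attributes be split into the set $E$ of those whose values are observed, with observed value $e$, and the set $R$ of the remaining ones, whose values are missing. Let $A_1,\dots,A_m$ ($m\le n$) be the children of $C$, numbered so that the order $A_1,A_2,\dots,A_m$ extends the partial order on the children of $C$ given by the arcs of the graph. Let $c',c''\in\mathcal{C}$. Then $c'$ credal-dominates $c''$ if and only if $\mu_{A_0}>1$, where $\mu_{A_0}$ is the value computed by the recursion $$\mu_{A_{m+1}}=1,$$ $$\mu_{A_i}=\min_{\substack{a_j\in\mathcal{A}_j\\ A_j\in(\Pi^+_{A_i}\setminus\Pi^*_{A_i})\cap R}}\left[\frac{p_0(a_i|\pi'_{A_i})}{p_0(a_i|\pi''_{A_i})}\,\mu_{A_{i+1}}\right],\qquad i=m,m-1,\dots,1,$$ $$\mu_{A_0}=\min_{\substack{a_j\in\mathcal{A}_j\\ A_j\in\Pi_C\cap R}}\left[\frac{p_0(c'|\pi_C)}{p_0(c''|\pi_C)}\,\mu_{A_1}\right],$$ with the notation defined in the context.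
   Context: A Bayesian network over $C,A_1,\dots,A_n$ (with finite non-empty value sets $\mathcal{C},\mathcal{A}_1,\dots,\mathcal{A}_n$) is a directed acyclic graph with these nodes together with, for each node $Z$ and each joint value $\pi_Z$ of its set of parents $\Pi_Z$, a conditional mass function $p_0(\cdot|\pi_Z)$ on the value set of $Z$. It determines the joint mass function $p_0(c,a_1,\dots,a_n)=p_0(c|\pi_C)\prod_{i=1}^n p_0(a_i|\pi_{A_i})$, where the parent values are those consistent with $(c,a_1,\dots,a_n)$. It is assumed that every joint instance has strictly positive probability. Let $\mathcal{R}$ be the set of joint values $r$ of the attributes in $R$; for $r\in\mathcal{R}$, $(e,r)$ is a complete value of all the attributes. For a real function $f$ on $\mathcal{C}$, $P_0(f|e,r)=\sum_{c\in\mathcal{C}}f(c)\,p_0(c|e,r)$, and the lower prevision of $f$ conditional on the incomplete observation is $\underline{R}(f|e,* )=\min_{r\in\mathcal{R}}P_0(f|e,r)$ (the conservative updating rule). The class $c'$ credal-dominates $c''$ if $\underline{R}(I_{\{c'\}}-I_{\{c''\}}|e,* )>0$, where $I_{\{c\}}$ is the indicator of $c$. Notation for the recursion: $A_0=C$. For $i=0,\dots,m$, $\Pi^+_{A_i}=\Pi_{A_i}\cup\{A_i\}$, and for $i=1,\dots,m$, $\Pi^*_{A_i}=\bigcup_{j=0}^{i-1}\Pi^+_{A_j}$. For a child $A_i$ of $C$, $\pi'_{A_i}$ and $\pi''_{A_i}$ denote the values of the parents of $A_i$ consistent with $(c',e,r)$ and $(c'',e,r)$ respectively; $\pi_C$ is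 the value of the parents of $C$ consistent with $(e,r)$. Here attributes in $E$ are always fixed at their observed values in $e$, while the values of attributes in $R$ are free variables. In each step the minimum is taken over the values $a_j\in\mathcal{A}_j$ of the indicated attributes $A_j$ (a minimum over an empty set of variables means that no minimisation is performed); accordingly each $\mu_{A_i}$, $i=1,\dots,m$, is in general a function of the values of the attributes in $R$ that occur in the expression being minimised and have not been minimised over. *)

theory Defs
  imports Complex_Main "HOL-Library.FuncSet" "HOL-Library.Indicator_Function"
begin

text \<open>
  The nodes of a network with \<open>n\<close> attributes are \<open>0, \<dots>, n\<close>: node \<open>0\<close> is the class variable
  \<open>C = A\<^sub>0\<close> and node \<open>i \<ge> 1\<close> is the attribute \<open>A\<^sub>i\<close>. The value sets are subsets of one common
  type and may differ from node to node. A joint value of a set \<open>S\<close> of nodes is an element of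
  \<open>Pi\<^sub>E S (vals N)\<close>. The number \<open>cpt N i \<pi> a\<close> is \<open>p\<^sub>0(a | \<pi>)\<close> for the node \<open>i\<close>, where \<open>\<pi>\<close> is a
  joint value of its parents.
\<close>

record 'a bayes_net =
  num_attrs :: nat
  arcs :: "(nat \<times> nat) set"
  vals :: "nat \<Rightarrow> 'a set"
  cpt :: "nat \<Rightarrow> (nat \<Rightarrow> 'a) \<Rightarrow> 'a \<Rightarrow> real"

definition nodes :: "'a bayes_net \<Rightarrow> nat set" where
  "nodes N = {0..num_attrs N}"

definition parents :: "'a bayes_net \<Rightarrow> nat \<Rightarrow> nat set" where
  "parents N i = {j. (j, i) \<in> arcs N}"

definition children :: "'a bayes_net \<Rightarrow> nat \<Rightarrow> nat set" where
  "children N i = {j. (i, j) \<in> arcs N}"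

definition bayesian_network :: "'a bayes_net \<Rightarrow> bool" where
  "bayesian_network N \<longleftrightarrow>
     arcs N \<subseteq> nodes N \<times> nodes N \<and> acyclic (arcs N) \<and>
     (\<forall>i\<in>nodes N. finite (vals N i) \<and> vals N i \<noteq> {}) \<and>
     (\<forall>i\<in>nodes N. \<forall>\<pi>\<in>Pi\<^sub>E (parents N i) (vals N).
        (\<forall>a\<in>vals N i. 0 \<le> cpt N i \<pi> a) \<and> (\<Sum>a\<in>vals N i. cpt N i \<pi> a) = 1)"

definition joint_mass :: "'a bayes_net \<Rightarrow> (nat \<Rightarrow> 'a) \<Rightarrow> real" where
  "joint_mass N x = (\<Prod>i\<in>nodes N. cpt N i (restrict x (parents N i)) (x i))"

definition strictly_positive :: "'a bayes_net \<Rightarrow> bool" where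
  "strictly_positive N \<longleftrightarrow> (\<forall>x \<in> Pi\<^sub>E (nodes N) (vals N). 0 < joint_mass N x)"

text \<open>
  \<open>obs E e r\<close> is the attribute value \<open>(e, r)\<close>, and \<open>full c E e r\<close> is \<open>(c, e, r)\<close>. In the
  recursion, \<open>r\<close> may also be a value of only some of the unobserved attributes.
\<close>

definition obs :: "nat set \<Rightarrow> (nat \<Rightarrow> 'a) \<Rightarrow> (nat \<Rightarrow> 'a) \<Rightarrow> nat \<Rightarrow> 'a" where
  "obs E e r = (\<lambda>j. if j \<in> E then e j else r j)"

definition full :: "'a \<Rightarrow> nat set \<Rightarrow> (nat \<Rightarrow> 'a) \<Rightarrow> (nat \<Rightarrow> 'a) \<Rightarrow> nat \<Rightarrow> 'a" where
  "full c E e r = (obs E e r)(0 := c)"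

definition cond_mass ::
  "'a bayes_net \<Rightarrow> nat set \<Rightarrow> (nat \<Rightarrow> 'a) \<Rightarrow> (nat \<Rightarrow> 'a) \<Rightarrow> 'a \<Rightarrow> real" where
  "cond_mass N E e r c =
     joint_mass N (full c E e r) / (\<Sum>d\<in>vals N 0. joint_mass N (full d E e r))"

definition cond_prevision ::
  "'a bayes_net \<Rightarrow> nat set \<Rightarrow> (nat \<Rightarrow> 'a) \<Rightarrow> (nat \<Rightarrow> 'a) \<Rightarrow> ('a \<Rightarrow> real) \<Rightarrow> real" where
  "cond_prevision N E e r f = (\<Sum>c\<in>vals N 0. f c * cond_mass N E e r c)"

definition lower_prevision ::
  "'a bayes_net \<Rightarrow> nat set \<Rightarrow> nat set \<Rightarrow> (nat \<Rightarrow> 'a) \<Rightarrow> ('a \<Rightarrow> real) \<Rightarrow> real" where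
  "lower_prevision N E R e f = Min ((\<lambda>r. cond_prevision N E e r f) ` Pi\<^sub>E R (vals N))"

definition credal_dominates ::
  "'a bayes_net \<Rightarrow> nat set \<Rightarrow> nat set \<Rightarrow> (nat \<Rightarrow> 'a) \<Rightarrow> 'a \<Rightarrow> 'a \<Rightarrow> bool" where
  "credal_dominates N E R e c' c'' \<longleftrightarrow>
     lower_prevision N E R e (\<lambda>c. indicator {c'} c - indicator {c''} c) > 0"

definition parents_plus :: "'a bayes_net \<Rightarrow> nat \<Rightarrow> nat set" where
  "parents_plus N i = parents N i \<union> {i}"

definition parents_star :: "'a bayes_net \<Rightarrow> nat \<Rightarrow> nat set" where
  "parents_star N i = (\<Union>j\<in>{0..<i}. parents_plus N j)"

text \<open>
  For \<open>1 \<le> i \<le> m\<close>, \<open>mu N E R e m c' c'' i s\<close> is \<open>\<mu>\<close> of \<open>A\<^sub>i\<close> as a function of the values \<open>s\<close> of the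
  unobserved attributes in \<open>parents_star N i\<close>, which are the only ones that can still be free
  at this step. The minimum is over the values \<open>t\<close> of the remaining unobserved attributes
  of \<open>parents_plus N i\<close>, and \<open>override_on s t D\<close> is \<open>s\<close> extended by \<open>t\<close>. If \<open>D\<close> is empty, then
  \<open>Pi\<^sub>E D (vals N)\<close> is a singleton, so that nothing is minimised.
\<close>

definition mu_vars :: "'a bayes_net \<Rightarrow> nat set \<Rightarrow> nat \<Rightarrow> nat set" where
  "mu_vars N R i = (parents_plus N i - parents_star N i) \<inter> R"

definition child_ratio ::
  "'a bayes_net \<Rightarrow> nat set \<Rightarrow> (nat \<Rightarrow> 'a) \<Rightarrow> 'a \<Rightarrow> 'a \<Rightarrow> nat \<Rightarrow> (nat \<Rightarrow> 'a) \<Rightarrow> real" where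
  "child_ratio N E e c' c'' i s =
     cpt N i (restrict (full c' E e s) (parents N i)) (obs E e s i) /
     cpt N i (restrict (full c'' E e s) (parents N i)) (obs E e s i)"

function mu ::
  "'a bayes_net \<Rightarrow> nat set \<Rightarrow> nat set \<Rightarrow> (nat \<Rightarrow> 'a) \<Rightarrow> nat \<Rightarrow> 'a \<Rightarrow> 'a \<Rightarrow> nat \<Rightarrow> (nat \<Rightarrow> 'a) \<Rightarrow> real"
where
  "mu N E R e m c' c'' i s =
     (if i > m then 1
      else Min ((\<lambda>t. child_ratio N E e c' c'' i (override_on s t (mu_vars N R i)) *
                     mu N E R e m c' c'' (i + 1) (override_on s t (mu_vars N R i)))
                ` Pi\<^sub>E (mu_vars N R i) (vals N)))"
  by pat_completeness auto
termination
  by (relation "measure (\<lambda>(N, E, R, e, m, c', c'', i, s). Suc m - i)") auto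

declare mu.simps [simp del]

text \<open>
  The last step, \<open>\<mu>\<close> of \<open>A\<^sub>0\<close>; no free attribute is left, so this is a number.
\<close>

definition mu_class ::
  "'a bayes_net \<Rightarrow> nat set \<Rightarrow> nat set \<Rightarrow> (nat \<Rightarrow> 'a) \<Rightarrow> nat \<Rightarrow> 'a \<Rightarrow> 'a \<Rightarrow> real" where
  "mu_class N E R e m c' c'' =
     Min ((\<lambda>s. cpt N 0 (restrict (obs E e s) (parents N 0)) c' /
               cpt N 0 (restrict (obs E e s) (parents N 0)) c'' *
               mu N E R e m c' c'' 1 s)
          ` Pi\<^sub>E (parents N 0 \<inter> R) (vals N))"

end

theory Submission
  imports Defs
begin

text \<open>
  The denominators of \<open>p\<^sub>0(c' | e, r)\<close> and \<open>p\<^sub>0(c'' | e, r)\<close> agree and are positive, so dominance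
  means that \<open>p\<^sub>0(c', e, r) / p\<^sub>0(c'', e, r) > 1\<close> for every \<open>r\<close>. Only the factors of \<open>C\<close> and of
  its children survive in this ratio. Rather than commuting products with minima, we compare with
  a variable threshold: as the ratios are positive, \<open>k < \<rho> * \<mu>\<close> iff \<open>k / \<rho> < \<mu>\<close>, and so
  \<open>k < \<mu>\<close> of \<open>A\<^sub>i\<close> at \<open>s\<close> holds iff \<open>k\<close> is below the product of the ratios of \<open>A\<^sub>i, \<dots>, A\<^sub>m\<close> at every
  full completion \<open>r\<close> of \<open>s\<close>.
\<close>

locale class_network =
  fixes N :: "'a bayes_net"
    and m :: nat
    and E R :: "nat set"
    and e :: "nat \<Rightarrow> 'a"
    and c' c'' :: 'a
  assumes bn: "bayesian_network N"
    and pos: "strictly_positive N"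
    and ER: "E \<union> R = {1..num_attrs N}"
    and e: "e \<in> Pi\<^sub>E E (vals N)"
    and children_class: "children N 0 = {1..m}"
    and c': "c' \<in> vals N 0" and c'': "c'' \<in> vals N 0"
begin

abbreviation ratio :: "nat \<Rightarrow> (nat \<Rightarrow> 'a) \<Rightarrow> real" where
  "ratio \<equiv> child_ratio N E e c' c''"

text \<open>The factor that \<open>C\<close> itself contributes to the odds of \<open>c'\<close>
  against \<open>c''\<close>. One conditioning value serves for both classes, since acyclicity keeps
  \<open>C\<close> out of its own parents.\<close>

definition class_ratio :: "(nat \<Rightarrow> 'a) \<Rightarrow> real" where
  "class_ratio s = cpt N 0 (restrict (obs E e s) (parents N 0)) c' /
                   cpt N 0 (restrict (obs E e s) (parents N 0)) c''"

section \<open>Value sets and completions of partial values\<close>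

lemma finite_vals: "i \<in> nodes N \<Longrightarrow> finite (vals N i)"
  and vals_nonempty: "i \<in> nodes N \<Longrightarrow> vals N i \<noteq> {}"
  using bn by (auto simp: bayesian_network_def)

lemma parents_subset: "parents N i \<subseteq> nodes N"
  using bn by (auto simp: bayesian_network_def parents_def)

lemma not_parent_self: "i \<notin> parents N i"
  using bn by (auto simp: bayesian_network_def parents_def acyclic_def)

lemma nodes_eq: "nodes N = insert 0 (E \<union> R)"
  unfolding ER by (auto simp: nodes_def)

lemma R_subset: "R \<subseteq> nodes N"
  by (auto simp: nodes_eq)

lemma zero_notin_E: "0 \<notin> E" and zero_notin_R: "0 \<notin> R"
proof -
  have "0 \<notin> E \<union> R" by (simp add: ER)
  then show "0 \<notin> E" "0 \<notin> R" by auto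
qed

lemma m_le: "m \<le> num_attrs N"
proof (cases "m = 0")
  case False
  then have "(0, m) \<in> arcs N"
    using children_class by (auto simp: children_def)
  then show ?thesis using bn by (auto simp: bayesian_network_def nodes_def)
qed simp

lemma finite_PiE_vals: "D \<subseteq> R \<Longrightarrow> finite (Pi\<^sub>E D (vals N))"
  using R_subset by (intro finite_PiE finite_subset[of D "nodes N"] finite_vals)
    (auto simp: nodes_def)

lemma PiE_vals_nonempty: "D \<subseteq> R \<Longrightarrow> Pi\<^sub>E D (vals N) \<noteq> {}"
  using R_subset vals_nonempty by (auto simp: PiE_eq_empty_iff)

text \<open>Non-empty value sets allow the missing attributes to be filled arbitrarily, here by
  \<open>q\<close>. Completions serve two ends: positivity of the ratios is known only at full
  values of \<open>R\<close>, and universal claims about completions must not hold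
  vacuously.\<close>

lemma ex_completion:
  assumes "\<And>j. j \<in> A \<inter> R \<Longrightarrow> s j \<in> vals N j"
  obtains r where "r \<in> Pi\<^sub>E R (vals N)" "\<And>j. j \<in> A \<inter> R \<Longrightarrow> r j = s j"
proof -
  obtain q where q: "q \<in> Pi\<^sub>E R (vals N)" using PiE_vals_nonempty[of R] by auto
  have "override_on q s (A \<inter> R) \<in> Pi\<^sub>E R (vals N)"
    using q assms by (auto simp: override_on_def PiE_iff extensional_def)
  then show ?thesis by (rule that) auto
qed

section \<open>Positivity of the factors\<close>

lemma full_in_PiE:
  assumes "r \<in> Pi\<^sub>E R (vals N)" "c \<in> vals N 0"
  shows "full c E e r \<in> Pi\<^sub>E (nodes N) (vals N)"
  using assms e zero_notin_E zero_notin_R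
  by (auto simp: full_def obs_def nodes_eq PiE_iff extensional_def)

text \<open>One vanishing factor would make the whole joint mass vanish, so positivity passes from
  the product to each of its nonnegative factors.\<close>

lemma cpt_pos:
  assumes x: "x \<in> Pi\<^sub>E (nodes N) (vals N)" and i: "i \<in> nodes N"
  shows "0 < cpt N i (restrict x (parents N i)) (x i)"
proof -
  have "restrict x (parents N i) \<in> Pi\<^sub>E (parents N i) (vals N)"
    using x parents_subset by auto
  then have "0 \<le> cpt N i (restrict x (parents N i)) (x i)"
    using bn x i by (auto simp: bayesian_network_def PiE_iff)
  moreover have "cpt N i (restrict x (parents N i)) (x i) \<noteq> 0"
  proof
    assume "cpt N i (restrict x (parents N i)) (x i) = 0"
    then have "joint_mass N x = 0"
      using i by (auto simp: joint_mass_def nodes_def intro!: prod_zero)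
    then show False using pos x by (auto simp: strictly_positive_def)
  qed
  ultimately show ?thesis by simp
qed

lemma cpt_class_eq:
  "cpt N 0 (restrict (full c E e r) (parents N 0)) (full c E e r 0) =
   cpt N 0 (restrict (obs E e r) (parents N 0)) c"
proof -
  have "restrict (full c E e r) (parents N 0) = restrict (obs E e r) (parents N 0)"
    using not_parent_self[of 0] by (auto simp: full_def fun_eq_iff restrict_def)
  then show ?thesis by (simp add: full_def)
qed

lemma class_ratio_pos:
  assumes "r \<in> Pi\<^sub>E R (vals N)"
  shows "0 < class_ratio r"
  using cpt_pos[OF full_in_PiE[OF assms c'], of 0] cpt_pos[OF full_in_PiE[OF assms c''], of 0]
  by (simp add: class_ratio_def cpt_class_eq) (simp add: nodes_eq)

lemma ratio_pos:
  assumes "r \<in> Pi\<^sub>E R (vals N)" "i \<in> {1..m}"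
  shows "0 < ratio i r"
proof -
  have "i \<in> nodes N" "i \<noteq> 0" using assms m_le by (auto simp: nodes_def)
  then show ?thesis
    using cpt_pos[OF full_in_PiE[OF assms(1) c'], of i] cpt_pos[OF full_in_PiE[OF assms(1) c''], of i]
    by (simp add: child_ratio_def full_def)
qed

section \<open>Locality of the ratios\<close>

lemma class_ratio_cong:
  assumes "\<And>j. j \<in> parents N 0 \<inter> R \<Longrightarrow> s j = r j"
  shows "class_ratio s = class_ratio r"
proof -
  have "restrict (obs E e s) (parents N 0) = restrict (obs E e r) (parents N 0)"
    using assms parents_subset[of 0] not_parent_self[of 0] nodes_eq
    by (auto simp: restrict_def obs_def fun_eq_iff)
  then show ?thesis by (simp add: class_ratio_def)
qed

text \<open>A factor reads only its node and the parents of that node. Among these, observed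
  attributes are taken from \<open>e\<close> and the class is set to \<open>c'\<close> or
  \<open>c''\<close>, so only the members of \<open>R\<close> can make a difference.\<close>

lemma ratio_cong:
  assumes i: "i \<in> {1..m}" and agree: "\<And>j. j \<in> parents_plus N i \<inter> R \<Longrightarrow> s j = r j"
  shows "ratio i s = ratio i r"
proof -
  have "restrict (full c E e s) (parents N i) = restrict (full c E e r) (parents N i)" for c
    using agree parents_subset[of i] nodes_eq
    by (auto simp: restrict_def obs_def full_def fun_eq_iff parents_plus_def)
  moreover have "obs E e s i = obs E e r i"
    using agree i ER m_le by (auto simp: obs_def parents_plus_def)
  ultimately show ?thesis by (simp add: child_ratio_def)
qed

section \<open>Dominance in terms of the joint odds\<close>

lemma joint_mass_ratio:
  assumes r: "r \<in> Pi\<^sub>E R (vals N)"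
  shows "joint_mass N (full c' E e r) / joint_mass N (full c'' E e r) =
         class_ratio r * (\<Prod>i\<in>{1..m}. ratio i r)"
proof -
  define q where "q i = cpt N i (restrict (full c' E e r) (parents N i)) (full c' E e r i) /
     cpt N i (restrict (full c'' E e r) (parents N i)) (full c'' E e r i)" for i
  have child: "q i = ratio i r" if "i \<in> {1..m}" for i
    using that by (auto simp: q_def child_ratio_def full_def)
  \<comment> \<open>Such a node is neither \<open>C\<close> nor a child of \<open>C\<close>, so the
    class value enters neither its own value nor that of its parents, and its factor
    cancels.\<close>
  have other: "q i = 1" if i: "i \<in> nodes N - {0..m}" for i
  proof -
    have "0 \<notin> parents N i" "i \<noteq> 0"
      using i children_class by (auto simp: parents_def children_def)
    then have "restrict (full c' E e r) (parents N i) = restrict (full c'' E e r) (parents N i)"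
      and "full c' E e r i = full c'' E e r i"
      by (auto simp: full_def restrict_def fun_eq_iff)
    then show ?thesis
      using cpt_pos[OF full_in_PiE[OF r c''], of i] i by (simp add: q_def)
  qed
  have "joint_mass N (full c' E e r) / joint_mass N (full c'' E e r) = prod q (nodes N)"
    by (simp add: joint_mass_def q_def prod_dividef)
  also have "\<dots> = prod q {0..m}"
    using m_le other by (intro prod.mono_neutral_right) (auto simp: nodes_def)
  also have "\<dots> = q 0 * prod q {1..m}"
    by (simp add: prod.atLeast_Suc_atMost)
  also have "q 0 = class_ratio r"
    by (simp add: q_def class_ratio_def cpt_class_eq)
  finally show ?thesis using child by simp
qed

text \<open>A minimum over finitely many completions is positive iff every entry is. Each entry is a
  difference of two posterior masses with a common positive denominator, so it is positive iff the
  joint odds exceed 1.\<close>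

lemma credal_dominates_iff:
  "credal_dominates N E R e c' c'' \<longleftrightarrow>
   (\<forall>r\<in>Pi\<^sub>E R (vals N). 1 < class_ratio r * (\<Prod>i\<in>{1..m}. ratio i r))"
proof -
  have fin: "finite (vals N 0)" using finite_vals nodes_eq by auto
  have "0 < cond_prevision N E e r (\<lambda>c. indicator {c'} c - indicator {c''} c) \<longleftrightarrow>
        1 < class_ratio r * (\<Prod>i\<in>{1..m}. ratio i r)" if r: "r \<in> Pi\<^sub>E R (vals N)" for r
  proof -
    have joint_pos: "0 < joint_mass N (full c E e r)" if "c \<in> vals N 0" for c
      using full_in_PiE[OF r that] pos by (auto simp: strictly_positive_def)
    define S where "S = (\<Sum>d\<in>vals N 0. joint_mass N (full d E e r))"
    have S: "0 < S"
      unfolding S_def using fin c' joint_pos by (intro sum_pos) auto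
    have "cond_prevision N E e r (\<lambda>c. indicator {c'} c - indicator {c''} c) =
          cond_mass N E e r c' - cond_mass N E e r c''"
      using fin c' c''
      by (simp add: cond_prevision_def left_diff_distrib sum_subtractf indicator_def
          if_distrib if_distribR sum.delta cong: if_cong)
    also have "\<dots> = (joint_mass N (full c' E e r) - joint_mass N (full c'' E e r)) / S"
      by (simp add: cond_mass_def S_def diff_divide_distrib)
    finally show ?thesis
      using S joint_pos[OF c''] unfolding joint_mass_ratio[OF r, symmetric]
      by (simp add: zero_less_divide_iff)
  qed
  then show ?thesis
    using finite_PiE_vals[of R] PiE_vals_nonempty[of R]
    by (simp add: credal_dominates_def lower_prevision_def)
qed

section \<open>Unfolding the recursion\<close>

lemma parents_star_Suc: "parents_star N (Suc i) = parents_star N i \<union> parents_plus N i"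
  by (auto simp: parents_star_def less_Suc_eq)

text \<open>Downward induction from the constant value at \<open>Suc m\<close>. Both
  \<open>k\<close> and \<open>s\<close> stay arbitrary, because the step applies the claim to
  \<open>k\<close> divided by a ratio and to \<open>s\<close> extended by the minimised
  values.\<close>

lemma mu_gt_iff:
  assumes "1 \<le> i" "i \<le> Suc m" "\<And>j. j \<in> parents_star N i \<inter> R \<Longrightarrow> s j \<in> vals N j"
  shows "k < mu N E R e m c' c'' i s \<longleftrightarrow>
    (\<forall>r\<in>Pi\<^sub>E R (vals N). (\<forall>j\<in>parents_star N i \<inter> R. r j = s j) \<longrightarrow>
       k < (\<Prod>j\<in>{i..m}. ratio j r))"
  using assms(2,1,3)
proof (induction i arbitrary: s k rule: inc_induct)
  case base
  \<comment> \<open>The empty product and \<open>mu\<close> are both 1 here; a completion must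
    exist, as otherwise the right-hand side would hold for every \<open>k\<close>.\<close>
  obtain r where "r \<in> Pi\<^sub>E R (vals N)" "\<forall>j\<in>parents_star N (Suc m) \<inter> R. r j = s j"
    using ex_completion[of "parents_star N (Suc m)" s] base by metis
  then show ?case by (auto simp: mu.simps)
next
  case (step i)
  define D where "D = mu_vars N R i"
  define ext where "ext t = override_on s t D" for t :: "nat \<Rightarrow> 'a"
  let ?P = "Pi\<^sub>E R (vals N)"
  let ?S = "\<lambda>i. parents_star N i \<inter> R"
  let ?prod = "\<lambda>i r. \<Prod>j\<in>{i..m}. ratio j r"
  have i: "i \<in> {1..m}" using step by auto
  \<comment> \<open>Disjointness ensures that extending \<open>s\<close> by \<open>t\<close> never
    overwrites a value that \<open>s\<close> already fixes.\<close>
  have D: "D \<subseteq> R" "?S (Suc i) = ?S i \<union> D" "D \<inter> ?S i = {}"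
    by (auto simp: D_def mu_vars_def parents_star_Suc)
  have ext_vals: "ext t j \<in> vals N j" if "t \<in> Pi\<^sub>E D (vals N)" "j \<in> ?S (Suc i)" for t j
    using that D step.prems by (auto simp: ext_def override_on_def PiE_iff)
  have ratio_ext: "ratio i (ext t) = ratio i r"
    if "\<forall>j\<in>?S (Suc i). r j = ext t j" for t r
    using i that by (intro ratio_cong) (auto simp: parents_star_Suc)
  have one: "k < ratio i (ext t) * mu N E R e m c' c'' (Suc i) (ext t) \<longleftrightarrow>
      (\<forall>r\<in>?P. (\<forall>j\<in>?S (Suc i). r j = ext t j) \<longrightarrow> k < ?prod i r)"
    if t: "t \<in> Pi\<^sub>E D (vals N)" for t
  proof -
    \<comment> \<open>\<open>ext t\<close> is only a partial value; the positivity of its ratio is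
      borrowed from a completion \<open>q\<close>, where the ratio is the same.\<close>
    obtain q where "q \<in> ?P" "\<forall>j\<in>?S (Suc i). q j = ext t j"
      using ex_completion[of "parents_star N (Suc i)" "ext t"] ext_vals[OF t] by metis
    then have rp: "0 < ratio i (ext t)" using ratio_ext ratio_pos[OF _ i] by auto
    then have "k < ratio i (ext t) * mu N E R e m c' c'' (Suc i) (ext t) \<longleftrightarrow>
      k / ratio i (ext t) < mu N E R e m c' c'' (Suc i) (ext t)"
      by (simp add: pos_divide_less_eq mult.commute)
    also have "\<dots> \<longleftrightarrow> (\<forall>r\<in>?P. (\<forall>j\<in>?S (Suc i). r j = ext t j) \<longrightarrow>
       k / ratio i (ext t) < ?prod (Suc i) r)"
      using step.IH[of "ext t"] ext_vals[OF t] by simp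
    also have "\<dots> \<longleftrightarrow> (\<forall>r\<in>?P. (\<forall>j\<in>?S (Suc i). r j = ext t j) \<longrightarrow> k < ?prod i r)"
    proof -
      \<comment> \<open>Multiplying back by the ratio restores the factor of index \<open>i\<close>
        in the product.\<close>
      have "k / ratio i (ext t) < ?prod (Suc i) r \<longleftrightarrow> k < ?prod i r"
        if "\<forall>j\<in>?S (Suc i). r j = ext t j" for r
        using i rp unfolding ratio_ext[OF that]
        by (simp add: prod.atLeast_Suc_atMost pos_divide_less_eq mult.commute)
      then show ?thesis by blast
    qed
    finally show ?thesis .
  qed
  have "k < mu N E R e m c' c'' i s \<longleftrightarrow>
    (\<forall>t\<in>Pi\<^sub>E D (vals N). k < ratio i (ext t) * mu N E R e m c' c'' (Suc i) (ext t))"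
    using i finite_PiE_vals[OF D(1)] PiE_vals_nonempty[OF D(1)]
    by (subst mu.simps) (simp add: D_def ext_def)
  also have "\<dots> \<longleftrightarrow> (\<forall>t\<in>Pi\<^sub>E D (vals N). \<forall>r\<in>?P.
      (\<forall>j\<in>?S (Suc i). r j = ext t j) \<longrightarrow> k < ?prod i r)"
    using one by auto
  \<comment> \<open>The completions of \<open>s\<close> are exactly those of the various
    \<open>ext t\<close>: a given \<open>r\<close> belongs to the \<open>t\<close> obtained by
    restricting it to \<open>D\<close>.\<close>
  also have "\<dots> \<longleftrightarrow> (\<forall>r\<in>?P. (\<forall>j\<in>?S i. r j = s j) \<longrightarrow> k < ?prod i r)"
  proof (intro iffI ballI impI)
    fix r assume *: "\<forall>t\<in>Pi\<^sub>E D (vals N). \<forall>r\<in>?P.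
        (\<forall>j\<in>?S (Suc i). r j = ext t j) \<longrightarrow> k < ?prod i r"
      and r: "r \<in> ?P" "\<forall>j\<in>?S i. r j = s j"
    have "restrict r D \<in> Pi\<^sub>E D (vals N)" using r(1) D(1) by auto
    moreover have "\<forall>j\<in>?S (Suc i). r j = ext (restrict r D) j"
      using r(2) D by (auto simp: ext_def override_on_def)
    ultimately show "k < ?prod i r" using * r(1) by blast
  next
    fix t r assume "\<forall>r\<in>?P. (\<forall>j\<in>?S i. r j = s j) \<longrightarrow> k < ?prod i r"
      and "r \<in> ?P" and r: "\<forall>j\<in>?S (Suc i). r j = ext t j"
    moreover have "\<forall>j\<in>?S i. r j = s j"
    proof
      fix j assume "j \<in> ?S i"
      then have "j \<in> ?S (Suc i)" "j \<notin> D" using D by blast+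
      then show "r j = s j" using r by (auto simp: ext_def)
    qed
    ultimately show "k < ?prod i r" by blast
  qed
  finally show ?case .
qed

text \<open>The threshold argument once more, with the unobserved parents of \<open>C\<close> as
  variables. No value is fixed beforehand, so the completions are all values of
  \<open>R\<close>.\<close>

lemma mu_class_gt_iff:
  "k < mu_class N E R e m c' c'' \<longleftrightarrow>
   (\<forall>r\<in>Pi\<^sub>E R (vals N). k < class_ratio r * (\<Prod>i\<in>{1..m}. ratio i r))"
proof -
  define D where "D = parents N 0 \<inter> R"
  let ?P = "Pi\<^sub>E R (vals N)"
  let ?prod = "\<lambda>r. \<Prod>i\<in>{1..m}. ratio i r"
  \<comment> \<open>As the class is not in \<open>R\<close>, the attributes left free in the first
    child's step are exactly those minimised over here.\<close>
  have D: "D \<subseteq> R" "parents_star N 1 \<inter> R = D"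
    using zero_notin_R by (auto simp: D_def parents_star_def parents_plus_def)
  have one: "k < class_ratio s * mu N E R e m c' c'' 1 s \<longleftrightarrow>
      (\<forall>r\<in>?P. (\<forall>j\<in>D. r j = s j) \<longrightarrow> k < class_ratio r * ?prod r)"
    if s: "s \<in> Pi\<^sub>E D (vals N)" for s
  proof -
    have cong: "class_ratio s = class_ratio r" if "\<forall>j\<in>D. r j = s j" for r
      using that by (intro class_ratio_cong) (auto simp: D_def)
    obtain q where "q \<in> ?P" "\<forall>j\<in>D. q j = s j"
      using ex_completion[of D s] s D(1) by (metis IntE PiE_mem inf.absorb1)
    then have "0 < class_ratio s" using class_ratio_pos cong by auto
    \<comment> \<open>Needed for every threshold, since it is used at
      \<open>k / class_ratio s\<close>.\<close>
    moreover have "k' < mu N E R e m c' c'' 1 s \<longleftrightarrow>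
        (\<forall>r\<in>?P. (\<forall>j\<in>D. r j = s j) \<longrightarrow> k' < ?prod r)" for k'
      using mu_gt_iff[of 1 s k'] s unfolding D(2) by auto
    ultimately have "k < class_ratio s * mu N E R e m c' c'' 1 s \<longleftrightarrow>
        (\<forall>r\<in>?P. (\<forall>j\<in>D. r j = s j) \<longrightarrow> k < class_ratio s * ?prod r)"
      by (metis pos_divide_less_eq mult.commute)
    then show ?thesis using cong by metis
  qed
  have "k < mu_class N E R e m c' c'' \<longleftrightarrow>
    (\<forall>s\<in>Pi\<^sub>E D (vals N). k < class_ratio s * mu N E R e m c' c'' 1 s)"
    using finite_PiE_vals[OF D(1)] PiE_vals_nonempty[OF D(1)]
    by (simp add: mu_class_def D_def class_ratio_def)
  also have "\<dots> \<longleftrightarrow> (\<forall>s\<in>Pi\<^sub>E D (vals N). \<forall>r\<in>?P.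
      (\<forall>j\<in>D. r j = s j) \<longrightarrow> k < class_ratio r * ?prod r)"
    using one by auto
  also have "\<dots> \<longleftrightarrow> (\<forall>r\<in>?P. k < class_ratio r * ?prod r)"
  proof (intro iffI ballI impI)
    fix r assume *: "\<forall>s\<in>Pi\<^sub>E D (vals N). \<forall>r\<in>?P.
        (\<forall>j\<in>D. r j = s j) \<longrightarrow> k < class_ratio r * ?prod r" and r: "r \<in> ?P"
    have "restrict r D \<in> Pi\<^sub>E D (vals N)" using r D(1) by auto
    then show "k < class_ratio r * ?prod r" using * r by fastforce
  qed blast
  finally show ?thesis .
qed

end

theorem theorem3:
  fixes N :: "'a bayes_net"
    and m :: nat
    and E R :: "nat set"
    and e :: "nat \<Rightarrow> 'a"
    and c' c'' :: 'a
  assumes "bayesian_network N"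
    and "strictly_positive N"
    and "E \<union> R = {1..num_attrs N}" and "E \<inter> R = {}"
    and "e \<in> Pi\<^sub>E E (vals N)"
    and "m \<le> num_attrs N"
    and "children N 0 = {1..m}"
    and "\<forall>i\<in>{1..m}. \<forall>j\<in>{1..m}. (i, j) \<in> (arcs N)\<^sup>+ \<longrightarrow> i < j"
    and "c' \<in> vals N 0" and "c'' \<in> vals N 0"
  shows "credal_dominates N E R e c' c'' \<longleftrightarrow> mu_class N E R e m c' c'' > 1"
proof -
  interpret class_network N m E R e c' c''
    using assms by unfold_locales
  \<comment> \<open>At threshold 1 both sides say that the odds exceed 1 at every
    completion.\<close>
  show ?thesis by (simp add: credal_dominates_iff mu_class_gt_iff)
qed

end
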